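(* Suppose there exists $x^*\in\mathbb{R}^p$ with $F(x^* )=0$. If $F(x)\in\mathrm{Im}(DF(x)^\top)$ for all $x\in\mathbb{R}^p$, then $$\Big\{x\in\mathbb{R}^p\ \Big|\ x=\mathbb{E}_{\mathbf{S}\sim\mathcal{D}_x}\big[\Pi_{\mathcal{L}_{\mathbf{S},x}}(x)\big]\Big\}=\operatorname*{argmin}_{x\in\mathbb{R}^p}\ \tfrac12\|F(x)\|^2_{\mathbb{E}_{\mathbf{S}\sim\mathcal{D}_x}[\mathbf{H}_{\mathbf{S}}(x)]}.$$
   Context: $F:\mathbb{R}^p\to\mathbb{R}^m$ is continuously differentiable and $DF(x)=[\nabla F_1(x)\ \cdots\ \nabla F_m(x)]\in\mathbb{R}^{p\times m}$ is the transpose of its Jacobian. For each $x$, $\mathcal{D}_x$ is a probability distribution over sketching matrices $\mathbf{S}\in\mathbb{R}^{m\times\tau}$. $\dagger$ is the Moore-Penrose pseudoinverse, $\mathbf{H}_{\mathbf{S}}(x)=\mathbf{S}\big(\mathbf{S}^\top DF(x)^\top DF(x)\mathbf{S}\big)^\dagger\mathbf{S}^\top$, with expectation understood to be finite, and $\|v\|_{\mathbf{M}}=\sqrt{v^\top\mathbf{M}v}$ for symmetric positive semidefinite $\mathbf{M}$. For $y\in\mathbb{R}^p$ and $\mathbf{S}\in\mathbb{R}^{m\times\tau}$, $$\mathcal{L}_{\mathbf{S},y}=\{x\in\mathbb{R}^p\mid\mathbf{S}^\top DF(y)^\top(x-y)=-\mathbf{S}^\top F(y)\},$$ and $\Pi_{\mathcal{Y}}$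 is the Euclidean projection onto a closed convex set $\mathcal{Y}$. $\mathrm{Im}$ is the image (column space). *)

theory Defs
  imports "HOL-Probability.Probability"
begin

(* Vectors and matrices are indexed by finite types: 'p, 'm and 't stand for the
   dimensions p, m and tau, and real^'c^'r is the type of matrices with rows indexed
   by 'r and columns indexed by 'c. *)

definition C1_map :: "(real^'p \<Rightarrow> real^'m) \<Rightarrow> bool" where
  "C1_map F \<longleftrightarrow>
     (\<forall>x. F differentiable (at x)) \<and> continuous_on UNIV (\<lambda>x. jacobian F (at x))"

(* The columns of DF F x are the gradients of the components of F. *)
definition DF :: "(real^'p \<Rightarrow> real^'m) \<Rightarrow> real^'p \<Rightarrow> real^'m^'p" where
  "DF F x = transpose (jacobian F (at x))"

definition column_space :: "real^'c^'r \<Rightarrow> (real^'r) set" where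
  "column_space A = range (\<lambda>v. A *v v)"

(* The unique matrix that satisfies the four Penrose equations. *)
definition pinv :: "real^'c^'r \<Rightarrow> real^'r^'c" where
  "pinv A = (THE B. A ** B ** A = A \<and> B ** A ** B = B \<and>
                    transpose (A ** B) = A ** B \<and> transpose (B ** A) = B ** A)"

definition H :: "(real^'p \<Rightarrow> real^'m) \<Rightarrow> real^'t^'m \<Rightarrow> real^'p \<Rightarrow> real^'m^'m" where
  "H F S x =
     S ** pinv (transpose S ** transpose (DF F x) ** DF F x ** S) ** transpose S"

definition wnorm :: "real^'n^'n \<Rightarrow> real^'n \<Rightarrow> real" where
  "wnorm M v = sqrt (v \<bullet> (M *v v))"

definition L :: "(real^'p \<Rightarrow> real^'m) \<Rightarrow> real^'t^'m \<Rightarrow> real^'p \<Rightarrow> (real^'p) set" where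
  "L F S y = {x. (transpose S ** transpose (DF F y)) *v (x - y) = - (transpose S *v F y)}"

definition argmin :: "('a \<Rightarrow> real) \<Rightarrow> 'a set" where
  "argmin f = {x. is_arg_min f (\<lambda>_. True) x}"

end

theory Submission
  imports Defs
begin

text \<open>Writing \<open>F x = DF\<^sup>T u\<close> and \<open>A = S\<^sup>T DF\<^sup>T\<close>, the affine set \<open>L\<close> is the nonempty fibre
  \<open>A (z - x) = - A u\<close>, so the projection of \<open>x\<close> is \<open>x - DF H F\<close>. Integrating, \<open>x\<close> is a fixed
  point iff \<open>DF M F = 0\<close> for the positive semidefinite matrix \<open>M = E H\<close>. Pairing with \<open>u\<close> gives
  \<open>F \<bullet> M F = 0\<close>, which conversely forces \<open>M F = 0\<close>. So the fixed points are the zeros of the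
  objective; they are its minimizers because the minimum 0 is attained at a root of \<open>F\<close>.\<close>

section \<open>Inner inverses of Gram matrices\<close>

lemma matrix_inner_inverse_exists:
  fixes A :: "real^'n^'m"
  shows "\<exists>G. A ** G ** A = A"
proof -
  have "linear ((*v) A)" by simp
  then obtain g where g: "linear g" "\<forall>v\<in>range ((*v) A). A *v g v = v"
    using linear_exists_right_inverse_on[of "(*v) A" UNIV] by auto
  have "(A ** matrix g ** A) *v v = A *v v" for v
    using g by (simp add: matrix_vector_mul_assoc[symmetric] matrix_works)
  then show ?thesis by (auto simp: matrix_eq)
qed

text \<open>The squared norm of \<open>transpose A *v z\<close> is the inner product of
  \<open>z\<close> with the Gram matrix applied to \<open>z\<close>.\<close>

lemma gram_kernel:
  fixes A :: "real^'n^'m"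
  assumes "(A ** transpose A) *v z = 0"
  shows "transpose A *v z = 0"
proof -
  have "(transpose A *v z) \<bullet> (transpose A *v z) = z \<bullet> ((A ** transpose A) *v z)"
    by (metis dot_lmul_matrix matrix_vector_mul_assoc transpose_matrix_vector)
  then show ?thesis using assms by simp
qed

text \<open>After transposing, both sides start with the Gram matrix; \<open>gram_kernel\<close>
  then removes the factor \<open>A\<close> from the difference applied to any vector.\<close>

lemma gram_cancel_right:
  fixes A :: "real^'n^'m" and X Y :: "real^'m^'k"
  assumes "X ** A ** transpose A = Y ** A ** transpose A"
  shows "X ** A = Y ** A"
proof -
  have eq: "A ** transpose A ** transpose X = A ** transpose A ** transpose Y"
    using arg_cong[OF assms, of transpose] by (simp add: matrix_transpose_mul matrix_mul_assoc)
  have "transpose A *v (transpose X *v v - transpose Y *v v) = 0" for v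
    by (rule gram_kernel)
      (metis eq matrix_vector_mul_assoc matrix_vector_mult_diff_distrib right_minus_eq)
  then have "(transpose A ** transpose X) *v v = (transpose A ** transpose Y) *v v" for v
    by (simp add: matrix_vector_mult_diff_distrib matrix_vector_mul_assoc
        del: transpose_matrix_vector)
  then have "transpose A ** transpose X = transpose A ** transpose Y"
    by (simp add: matrix_eq)
  then show ?thesis
    by (metis matrix_transpose_mul transpose_transpose)
qed

text \<open>Cancelling the trailing \<open>transpose A\<close> against the identity shows that
  \<open>transpose A ** G\<close> is an inner inverse of \<open>A\<close>.\<close>

lemma gram_inner_inverse:
  fixes A :: "real^'n^'m"
  assumes "A ** transpose A ** G ** (A ** transpose A) = A ** transpose A"
  shows "A ** transpose A ** G ** A = A"
  using gram_cancel_right[of "A ** transpose A ** G" A "mat 1"] assms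
  by (simp add: matrix_mul_assoc)

text \<open>Although \<open>G\<close> may be asymmetric, \<open>?P\<close> satisfies
  \<open>transpose ?P ** ?P = transpose ?P\<close>, whose left side is symmetric. In fact
  \<open>?P\<close> is the orthogonal projection onto the row space of \<open>A\<close>.\<close>

lemma gram_inner_inverse_symmetric:
  fixes A :: "real^'n^'m"
  assumes "A ** transpose A ** G ** (A ** transpose A) = A ** transpose A"
  shows "transpose (transpose A ** G ** A) = transpose A ** G ** A"
proof -
  let ?P = "transpose A ** G ** A"
  have "transpose ?P ** ?P = transpose A ** transpose G ** (A ** transpose A ** G ** A)"
    by (simp add: matrix_transpose_mul matrix_mul_assoc)
  also have "\<dots> = transpose ?P"
    by (simp add: gram_inner_inverse[OF assms] matrix_transpose_mul matrix_mul_assoc)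
  finally have "transpose ?P ** ?P = transpose ?P" .
  then show ?thesis
    by (metis matrix_transpose_mul transpose_transpose)
qed

section \<open>Existence and uniqueness of the pseudoinverse\<close>

definition penrose :: "real^'c^'r \<Rightarrow> real^'r^'c \<Rightarrow> bool" where
  "penrose A B \<longleftrightarrow> A ** B ** A = A \<and> B ** A ** B = B \<and>
     transpose (A ** B) = A ** B \<and> transpose (B ** A) = B ** A"

text \<open>\<open>A ** B\<close> and \<open>A ** C\<close> are both the orthogonal projection onto
  the range of \<open>A\<close>, while \<open>B ** A\<close> and \<open>C ** A\<close> both project
  onto its row space.\<close>

lemma penrose_unique:
  assumes B: "penrose A B" and C: "penrose A C"
  shows "B = C"
proof -
  have AB: "A ** B = A ** C"
  proof -
    have "A ** B = transpose (A ** C ** (A ** B))"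
      using B C by (simp add: penrose_def matrix_mul_assoc)
    also have "\<dots> = A ** B ** (A ** C)"
      using B C by (simp only: penrose_def matrix_transpose_mul[of "A ** C"])
    also have "\<dots> = A ** C"
      using B by (simp add: penrose_def matrix_mul_assoc)
    finally show ?thesis .
  qed
  have BA: "B ** A = C ** A"
  proof -
    have "B ** A = transpose (B ** A ** (C ** A))"
      using B C by (simp add: penrose_def flip: matrix_mul_assoc)
    also have "\<dots> = C ** A ** (B ** A)"
      using B C by (simp only: penrose_def matrix_transpose_mul[of "B ** A"])
    also have "\<dots> = C ** A"
      using B by (simp add: penrose_def flip: matrix_mul_assoc)
    finally show ?thesis .
  qed
  have "B = B ** (A ** B)" using B by (simp add: penrose_def matrix_mul_assoc)
  also have "\<dots> = C ** A ** C" by (simp add: AB BA matrix_mul_assoc)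
  also have "\<dots> = C" using C by (simp add: penrose_def)
  finally show ?thesis .
qed

lemma penrose_exists:
  fixes A :: "real^'n^'m"
  shows "\<exists>B. penrose A B"
proof -
  obtain G where G: "A ** transpose A ** G ** (A ** transpose A) = A ** transpose A"
    using matrix_inner_inverse_exists by blast
  obtain G' where G': "transpose A ** A ** G' ** (transpose A ** A) = transpose A ** A"
    using matrix_inner_inverse_exists by blast
  \<comment> \<open>This is \<open>X ** A ** Y\<close> for two inner inverses of \<open>A\<close>:
    \<open>X = transpose A ** G\<close> makes \<open>X ** A\<close> symmetric, and
    \<open>Y = G' ** transpose A\<close> makes \<open>A ** Y\<close> symmetric. The product has both
    symmetries, since \<open>A ** ?B = A ** Y\<close> and \<open>?B ** A = X ** A\<close>.\<close>
  let ?B = "transpose A ** G ** A ** G' ** transpose A"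
  have 1: "A ** transpose A ** G ** A = A" by (rule gram_inner_inverse[OF G])
  have 2: "transpose A ** A ** G' ** transpose A = transpose A"
    using gram_inner_inverse[of "transpose A" G'] G' by simp
  have sG: "transpose (transpose A ** G ** A) = transpose A ** G ** A"
    by (rule gram_inner_inverse_symmetric[OF G])
  have sG': "transpose (A ** G' ** transpose A) = A ** G' ** transpose A"
    using gram_inner_inverse_symmetric[of "transpose A" G'] G' by simp
  have 3: "A ** G' ** transpose A ** A = A"
    using arg_cong[OF 2, of transpose] sG'
    by (metis matrix_mul_assoc matrix_transpose_mul transpose_transpose)
  have AB: "A ** ?B = A ** G' ** transpose A"
    by (simp add: matrix_mul_assoc 1)
  have BA: "?B ** A = transpose A ** G ** A"
    using 3 by (metis matrix_mul_assoc)
  have "?B ** A ** ?B = transpose A ** G ** (A ** ?B)"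
    by (simp only: BA matrix_mul_assoc)
  then have "?B ** A ** ?B = ?B" unfolding AB by (simp add: matrix_mul_assoc)
  then have "penrose A ?B"
    unfolding penrose_def AB BA using sG sG' 3 by simp
  then show ?thesis by blast
qed

lemma penrose_pinv: "penrose A (pinv A)"
proof -
  have "pinv A = (THE B. penrose A B)" by (simp add: pinv_def penrose_def)
  then show ?thesis
    using penrose_exists penrose_unique by (metis theI')
qed

lemma penrose_transpose: "penrose A B \<Longrightarrow> penrose (transpose A) (transpose B)"
  unfolding penrose_def by (metis matrix_mul_assoc matrix_transpose_mul transpose_transpose)

lemma pinv_symmetric: "transpose A = A \<Longrightarrow> transpose (pinv A) = pinv A"
  by (metis penrose_pinv penrose_transpose penrose_unique)

section \<open>Positive semidefiniteness of the sketched matrix\<close>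

lemma inner_transpose_mult:
  fixes A :: "real^'n^'m"
  shows "x \<bullet> (A *v y) = (transpose A *v x) \<bullet> y"
  by (simp add: dot_lmul_matrix)

text \<open>By \<open>?P = ?P ** ?B ** ?P\<close> and the symmetry of \<open>?P\<close>, the
  quadratic form is the squared norm of \<open>transpose A *v (?P *v v)\<close>.\<close>

lemma pinv_gram_psd:
  fixes A :: "real^'n^'m"
  shows "0 \<le> v \<bullet> (pinv (A ** transpose A) *v v)"
proof -
  let ?B = "A ** transpose A" and ?P = "pinv (A ** transpose A)"
  have sym: "transpose ?P = ?P"
    by (rule pinv_symmetric) (simp add: matrix_transpose_mul)
  have "?P = ?P ** ?B ** ?P" using penrose_pinv[of ?B] by (simp add: penrose_def)
  then have "v \<bullet> (?P *v v) = v \<bullet> (?P *v (A *v (transpose A *v (?P *v v))))"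
    by (metis matrix_vector_mul_assoc)
  also have "\<dots> = (transpose A *v (?P *v v)) \<bullet> (transpose A *v (?P *v v))"
    by (simp only: inner_transpose_mult sym)
  finally show ?thesis by simp
qed

text \<open>Exhibits the pseudoinverted matrix as the Gram matrix of
  \<open>transpose S ** transpose (DF F x)\<close>, the form to which the lemmas above
  apply.\<close>

lemma H_eq: "H F S x = S ** pinv ((transpose S ** transpose (DF F x)) **
    transpose (transpose S ** transpose (DF F x))) ** transpose S"
  by (simp add: H_def matrix_transpose_mul matrix_mul_assoc)

lemma H_symmetric: "transpose (H F S x) = H F S x"
  by (simp add: H_eq matrix_transpose_mul matrix_mul_assoc pinv_symmetric)

lemma H_psd: "0 \<le> v \<bullet> (H F S x *v v)"
proof -
  let ?P = "pinv ((transpose S ** transpose (DF F x)) **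
    transpose (transpose S ** transpose (DF F x)))"
  have "v \<bullet> (H F S x *v v) = (transpose S *v v) \<bullet> (?P *v (transpose S *v v))"
    by (simp only: H_eq matrix_vector_mul_assoc[symmetric] inner_transpose_mult[of v S])
  then show ?thesis using pinv_gram_psd by metis
qed

text \<open>\<open>A\<^sup>T w\<close> is orthogonal to the kernel of \<open>A\<close>, which is the direction of the affine set.\<close>
lemma closest_point_affine:
  fixes A :: "real^'n^'m"
  assumes "A *v (transpose A *v w) = - b"
  shows "closest_point {z. A *v (z - x) = b} x = x - transpose A *v w"
proof -
  let ?L = "{z. A *v (z - x) = b}" and ?y = "x - transpose A *v w"
  have lin: "A *v (- v) = - (A *v v)" for v
    using matrix_vector_mult_diff_distrib[of A 0 v] by simp
  have y: "?y \<in> ?L"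
    using assms by (simp add: lin)
  have conv: "convex ?L"
  proof (rule convexI)
    fix z z' :: "real^'n" and s t :: real
    assume h: "z \<in> ?L" "z' \<in> ?L" "0 \<le> s" "0 \<le> t" "s + t = 1"
    have "s *\<^sub>R z + t *\<^sub>R z' - x = s *\<^sub>R (z - x) + t *\<^sub>R (z' - x)"
      using h(5) by (simp add: algebra_simps flip: scaleR_add_left)
    then have "A *v (s *\<^sub>R z + t *\<^sub>R z' - x) = s *\<^sub>R b + t *\<^sub>R b"
      using h by (simp add: matrix_vector_right_distrib matrix_vector_mult_scaleR)
    then show "s *\<^sub>R z + t *\<^sub>R z' \<in> ?L"
      using h(5) by (simp flip: scaleR_add_left)
  qed
  have clo: "closed ?L"
    by (intro closed_Collect_eq continuous_intros
        bounded_linear.continuous_on[OF matrix_vector_mul_bounded_linear])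
  have "dist x ?y \<le> dist x z" if "z \<in> ?L" for z
  proof -
    have "A *v (z - ?y) = A *v (z - x) + A *v (transpose A *v w)"
      by (simp add: algebra_simps flip: matrix_vector_right_distrib)
    also have "\<dots> = 0" using that assms by simp
    finally have "(transpose A *v w) \<bullet> (z - ?y) = 0"
      by (metis inner_transpose_mult inner_zero_right)
    then have "orthogonal (x - ?y) (?y - z)"
      by (simp add: orthogonal_def inner_diff_right)
    then have "(norm (x - z))\<^sup>2 = (norm (x - ?y))\<^sup>2 + (norm (?y - z))\<^sup>2"
      using norm_add_Pythagorean by fastforce
    then show ?thesis
      by (metis dist_norm le_add_same_cancel1 norm_ge_zero power2_le_imp_le zero_le_power2)
  qed
  then show ?thesis
    using closest_point_unique[OF conv clo y] by simp
qed

lemma closest_point_L: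
  assumes "F x \<in> column_space (transpose (DF F x))"
  shows "closest_point (L F S x) x = x - DF F x *v (H F S x *v F x)"
proof -
  obtain u where u: "F x = transpose (DF F x) *v u"
    using assms by (auto simp: column_space_def)
  let ?A = "transpose S ** transpose (DF F x)"
  let ?P = "pinv (?A ** transpose ?A)"
  let ?w = "?P *v (transpose S *v F x)"
  have b: "transpose S *v F x = ?A *v u"
    by (simp only: u matrix_vector_mul_assoc)
  \<comment> \<open>On the range of \<open>?A\<close>, which contains
    \<open>transpose S *v F x\<close>, the product of the Gram matrix and its pseudoinverse is the
    identity. Hence \<open>?w\<close> solves the normal equation of the projection.\<close>
  have "?A ** transpose ?A ** ?P ** ?A = ?A"
    by (rule gram_inner_inverse) (use penrose_pinv[of "?A ** transpose ?A"] in \<open>simp add: penrose_def\<close>)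
  then have "?A *v (transpose ?A *v ?w) = - (- (transpose S *v F x))"
    unfolding b by (metis matrix_vector_mul_assoc minus_minus)
  from closest_point_affine[OF this, of x]
  have "closest_point (L F S x) x = x - transpose ?A *v ?w"
    by (simp add: L_def)
  also have "transpose ?A *v ?w = DF F x *v (H F S x *v F x)"
    by (simp add: H_eq matrix_transpose_mul matrix_vector_mul_assoc[symmetric] del: transpose_matrix_vector)
  finally show ?thesis .
qed

text \<open>If \<open>?w\<close> were nonzero, the form at \<open>v - s *\<^sub>R ?w\<close> would
  be negative for small positive \<open>s\<close>: its constant term vanishes and its linear term is
  \<open>- 2 * s * a\<close> with \<open>a > 0\<close>.\<close>

lemma psd_inner_zero:
  fixes M :: "real^'n^'n"
  assumes sym: "transpose M = M" and psd: "\<And>v. 0 \<le> v \<bullet> (M *v v)" and zero: "v \<bullet> (M *v v) = 0"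
  shows "M *v v = 0"
proof (rule ccontr)
  let ?w = "M *v v"
  assume "?w \<noteq> 0"
  define a where "a = ?w \<bullet> ?w"
  define c where "c = ?w \<bullet> (M *v ?w)"
  have a: "a > 0" using \<open>?w \<noteq> 0\<close> by (simp add: a_def)
  have c: "c \<ge> 0" using psd by (simp add: c_def)
  have vw: "v \<bullet> (M *v ?w) = a" by (simp only: inner_transpose_mult sym a_def)
  have q: "0 \<le> s\<^sup>2 * c - 2 * s * a" for s
    using psd[of "v - s *\<^sub>R ?w"] zero vw
    by (simp add: matrix_vector_mult_diff_distrib matrix_vector_mult_scaleR inner_diff
        power2_eq_square algebra_simps flip: a_def c_def)
  \<comment> \<open>The summand 1 covers the case \<open>c = 0\<close> and gives
    \<open>s * c < a\<close>.\<close>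
  define s where "s = a / (c + 1)"
  have s: "s > 0" using a c by (simp add: s_def)
  have "s * c < 2 * a"
    using a c by (simp add: s_def field_simps add_nonneg_pos)
  then have "s * (s * c - 2 * a) < 0" using s by (intro mult_pos_neg) auto
  then show False using q[of s] by (simp add: algebra_simps power2_eq_square)
qed

theorem lemmaA2:
  fixes F :: "real^'p \<Rightarrow> real^'m"
    and \<D> :: "real^'p \<Rightarrow> (real^'t^'m) measure"
  assumes "C1_map F"
    and "\<And>x. prob_space (\<D> x)"
    and "\<And>x. sets (\<D> x) = sets borel"
    and "\<And>x. integrable (\<D> x) (\<lambda>S. H F S x)"
    and "\<exists>x\<^sub>0. F x\<^sub>0 = 0"
    and "\<And>x. F x \<in> column_space (transpose (DF F x))"
  shows "{x. x = (LINT S|\<D> x. closest_point (L F S x) x)} =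
         argmin (\<lambda>x. 1/2 * (wnorm (LINT S|\<D> x. H F S x) (F x))\<^sup>2)"
proof -
  define M where "M x = (LINT S|\<D> x. H F S x)" for x
  \<comment> \<open>Evaluation at a vector and transposition are bounded linear, so they commute
    with the expectation; symmetry and semidefiniteness thus pass from \<open>H\<close> to
    \<open>M\<close>.\<close>
  have lin: "linear (\<lambda>X::real^'m^'m. X *v v)" for v
    by (auto intro!: linearI simp: matrix_vector_mult_add_rdistrib scaleR_matrix_vector_assoc)
  have bl: "bounded_linear (\<lambda>X::real^'m^'m. X *v v)" for v
    using lin by (rule linear_conv_bounded_linear[THEN iffD1])
  have bl_tr: "bounded_linear (transpose :: real^'m^'m \<Rightarrow> _)"
    by (intro linear_conv_bounded_linear[THEN iffD1] linearI)
      (auto simp: transpose_def vec_eq_iff)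
  have M_sym: "transpose (M x) = M x" for x
    using integral_bounded_linear[OF bl_tr assms(4)[of x]] by (simp add: M_def H_symmetric)
  have M_psd: "0 \<le> v \<bullet> (M x *v v)" for x v
  proof -
    have "v \<bullet> (M x *v v) = (LINT S|\<D> x. v \<bullet> (H F S x *v v))"
      unfolding M_def
      by (rule integral_bounded_linear[OF bounded_linear_compose[OF bounded_linear_inner_right bl]
            assms(4), symmetric])
    then show ?thesis by (simp add: H_psd)
  qed
  have int: "(LINT S|\<D> x. closest_point (L F S x) x) = x - DF F x *v (M x *v F x)" for x
  proof -
    interpret prob_space "\<D> x" by (rule assms(2))
    have bl': "bounded_linear (\<lambda>X. DF F x *v (X *v F x))"
      by (rule bounded_linear_compose[OF matrix_vector_mul_bounded_linear bl])
    have "(LINT S|\<D> x. closest_point (L F S x) x) =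
        (LINT S|\<D> x. x - DF F x *v (H F S x *v F x))"
      by (simp only: closest_point_L[of F x, OF assms(6)])
    \<comment> \<open>Integrability of the projection term comes from that of \<open>H\<close>
      through the bounded linear map \<open>bl'\<close>; total mass 1 makes the constant
      \<open>x\<close> integrate to itself.\<close>
    also have "\<dots> = (LINT S|\<D> x. x) - (LINT S|\<D> x. DF F x *v (H F S x *v F x))"
      by (intro Bochner_Integration.integral_diff integrable_bounded_linear[OF bl'] assms(4)) simp
    also have "\<dots> = x - DF F x *v (M x *v F x)"
      using integral_bounded_linear[OF bl' assms(4)] by (simp add: M_def prob_space)
    finally show ?thesis .
  qed
  have fixed: "x = (LINT S|\<D> x. closest_point (L F S x) x) \<longleftrightarrow> F x \<bullet> (M x *v F x) = 0" for x
  proof -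
    obtain u where u: "F x = transpose (DF F x) *v u"
      using assms(6)[of x] by (auto simp: column_space_def)
    have "F x \<bullet> (M x *v F x) = u \<bullet> (DF F x *v (M x *v F x))"
      by (subst u) (simp only: inner_transpose_mult)
    moreover have "M x *v F x = 0" if "F x \<bullet> (M x *v F x) = 0"
      using psd_inner_zero[OF M_sym M_psd that] .
    ultimately show ?thesis by (auto simp: int)
  qed
  have obj: "(wnorm (M x) (F x))\<^sup>2 = F x \<bullet> (M x *v F x)" for x
    by (simp add: wnorm_def M_psd)
  obtain x\<^sub>0 where "F x\<^sub>0 = 0" using assms(5) by blast
  then have "F x\<^sub>0 \<bullet> (M x\<^sub>0 *v F x\<^sub>0) = 0" by simp
  then have "is_arg_min (\<lambda>x. 1/2 * (F x \<bullet> (M x *v F x))) (\<lambda>_. True) x \<longleftrightarrow>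
      F x \<bullet> (M x *v F x) = 0" for x
    using M_psd[of "F x" x for x]
    by (auto simp: is_arg_min_linorder intro: order_antisym) (metis order_antisym)
  then show ?thesis
    by (simp add: fixed argmin_def obj flip: M_def)
qed

end
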